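(* Let $d\geq 1$ be an integer and let $0\leq \gamma \leq 1 \leq \beta <d$. Let $0 \leq \tilde\gamma \leq \gamma$, $0\leq \alpha \leq 1$, and $0 \leq \tilde \beta \leq \beta$. Then there is a constant $C$, independent of $f$, such that for all $f \in L^\infty(|x|^\gamma\mathrm{d}x) \cap L^\infty(|x|^\beta\mathrm{d}x)$, $$\sup_{x \in \mathbb R^d,\, t>0}\Big(|x|^{\tilde \gamma}t^{\frac{1}{2}(\gamma- \tilde \gamma)} + |x|^\alpha t^{\frac{1}{2}(1- \alpha)}+|x|^{\tilde\beta} t^{\frac{1}{2}(\beta- \tilde \beta)}\Big)|(e^{t\Delta}f)(x)| \leq C\Big( \|f\|_{L^\infty(|x|^\gamma\mathrm{d}x)}+\|f\|_{L^\infty(|x|^\beta\mathrm{d}x)}\Big).$$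
   Context: For $\beta\ge 0$, $L^\infty(|x|^\beta\mathrm{d}x)$ denotes the space of measurable functions $u$ on $\mathbb R^d$ (scalar- or vector-valued) with $\|u\|_{L^\infty(|x|^\beta\mathrm{d}x)} := \operatorname{ess\,sup}_{x\in\mathbb R^d}|x|^\beta|u(x)|<+\infty$ (with $|x|^0=1$). The heat semigroup is $e^{t\Delta}u(x)=\int_{\mathbb R^d}(4\pi t)^{-d/2}e^{-|x-y|^2/(4t)}u(y)\,\mathrm{d}y$ for $t>0$. *)

theory Defs
  imports "HOL-Analysis.Analysis" "HOL-Probability.Essential_Supremum"
begin

(* The power |x|^a with the convention |x|^0 = 1 for every x, including x = 0;
   plain powr would give 0 powr 0 = 0 at the origin. *)
definition norm_pow :: "real \<Rightarrow> 'a::real_normed_vector \<Rightarrow> real" where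
  "norm_pow a x = (if a = 0 then 1 else norm x powr a)"

definition wnorm :: "real \<Rightarrow> ('a::euclidean_space \<Rightarrow> 'b::euclidean_space) \<Rightarrow> ereal" where
  "wnorm b u = esssup lebesgue (\<lambda>x. ereal (norm_pow b x * norm (u x)))"

definition wLinfty :: "real \<Rightarrow> ('a::euclidean_space \<Rightarrow> 'b::euclidean_space) set" where
  "wLinfty b = {u \<in> borel_measurable lebesgue. wnorm b u < \<infinity>}"

(* Intended for t > 0. The integral is over lebesgue rather than lborel because functions
   in wLinfty are only Lebesgue measurable. *)
definition heat_semigroup ::
  "real \<Rightarrow> ('a::euclidean_space \<Rightarrow> 'b::euclidean_space) \<Rightarrow> 'a \<Rightarrow> 'b" where
  "heat_semigroup t u x =
     (LINT y|lebesgue. ((4 * pi * t) powr (- (real DIM('a) / 2))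
        * exp (- (norm (x - y))\<^sup>2 / (4 * t))) *\<^sub>R u y)"

end

theory Submission
  imports Defs "HOL-Probability.Distributions"
begin

(* Put r = max |x| (sqrt t) and let G be the heat kernel. For 0 <= a < d,
     int G_t(x - y) |y|^(-a) dy <= K r^(-a):
   where |y| >= r/2 the weight is at most (r/2)^(-a) and G has integral 1; where |y| < r/2,
   either |x - y| >= r/2 or r = sqrt t, so G is at most a multiple of r^(-d), while |y|^(-a)
   integrates over the ball to a multiple of r^(d-a). Interpolating between the two norms bounds
   |f(y)| by (||f||_gamma + ||f||_beta) |y|^(-a) for every a in [gamma, beta]; apply this with
   a = gamma, 1, beta and use |x|^b t^((a-b)/2) <= r^a for 0 <= b <= a. *)

lemma ex_dyadic_shell:
  fixes s R :: real
  assumes "0 < s" "s < R"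
  shows "\<exists>k. R * (1/2) ^ Suc k \<le> s \<and> s < R * (1/2) ^ k"
proof -
  have "\<exists>k. R * (1/2) ^ Suc k \<le> s"
  proof -
    obtain n where n: "(1/2::real) ^ n < s / R"
      using real_arch_pow_inv[of "s / R" "1/2"] assms by auto
    have "R * (1/2) ^ Suc n \<le> R * (1/2) ^ n"
      using assms by (simp add: field_simps)
    also have "\<dots> \<le> s" using n assms by (simp add: field_simps)
    finally show ?thesis by blast
  qed
  then obtain k where k: "R * (1/2) ^ Suc k \<le> s" "\<And>j. j < k \<Longrightarrow> \<not> R * (1/2) ^ Suc j \<le> s"
    using exists_least_iff[of "\<lambda>k. R * (1/2) ^ Suc k \<le> s"] by blast
  have "s < R * (1/2) ^ k"
  proof (cases k)
    case (Suc j)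
    with k(2)[of j] show ?thesis by simp
  qed (use assms in simp)
  with k(1) show ?thesis by blast
qed

lemma nn_integral_norm_powr_ball_le:
  fixes a :: real
  assumes "0 \<le> a" "a < real DIM('a::euclidean_space)"
  obtains K where "0 \<le> K"
    "\<And>R. 0 < R \<Longrightarrow> (\<integral>\<^sup>+y. ennreal (norm y powr (- a)) * indicator (ball (0::'a) R) y \<partial>lborel)
      \<le> ennreal (K * R powr (real DIM('a) - a))"
proof
  define d where "d = DIM('a)"
  define V where "V = unit_ball_vol (real d)"
  define q where "q = (1/2::real) powr (real d - a)"
  define K where "K = V * 2 powr a / (1 - q)"
  have V: "0 \<le> V" by (simp add: V_def)
  have q: "0 < q" "q < 1"
    using assms powr_less_mono2_neg[of "a - real d" 1 2]
    by (auto simp: q_def d_def powr_divide powr_minus field_simps)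
  show "0 \<le> K" using V q by (simp add: K_def)
  fix R :: real assume R: "0 < R"
  let ?c = "\<lambda>k. (R * (1/2) ^ Suc k) powr (- a)"
  have "(\<integral>\<^sup>+y. ennreal (norm y powr (- a)) * indicator (ball (0::'a) R) y \<partial>lborel)
    \<le> (\<integral>\<^sup>+y. (\<Sum>k. ennreal (?c k) * indicator (ball (0::'a) (R * (1/2)^k)) y) \<partial>lborel)"
  proof (rule nn_integral_mono_AE)
    show "AE y in lborel. ennreal (norm y powr (- a)) * indicator (ball (0::'a) R) y
      \<le> (\<Sum>k. ennreal (?c k) * indicator (ball (0::'a) (R * (1/2)^k)) y)"
      using AE_lborel_singleton[of "0::'a"]
    proof eventually_elim
      case (elim y)
      show ?case
      proof (cases "norm y < R")
        case True
        then obtain k where k: "R * (1/2) ^ Suc k \<le> norm y" "norm y < R * (1/2) ^ k"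
          using ex_dyadic_shell[of "norm y" R] elim by auto
        have "ennreal (norm y powr (- a)) * indicator (ball (0::'a) R) y \<le> ennreal (?c k)"
          using True k(1) R assms by (simp add: ennreal_leI powr_mono2')
        also have "\<dots> = (\<Sum>k\<in>{k}. ennreal (?c k) * indicator (ball (0::'a) (R * (1/2)^k)) y)"
          using k(2) by simp
        also have "\<dots> \<le> (\<Sum>k. ennreal (?c k) * indicator (ball (0::'a) (R * (1/2)^k)) y)"
          by (rule sum_le_suminf) auto
        finally show ?thesis .
      qed simp
    qed
  qed
  also have "\<dots> = (\<Sum>k. ennreal (?c k) * ennreal (V * (R * (1/2)^k) ^ d))"
  proof -
    have "(\<integral>\<^sup>+y. ennreal (?c k) * indicator (ball (0::'a) (R * (1/2)^k)) y \<partial>lborel)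
      = ennreal (?c k) * ennreal (V * (R * (1/2)^k) ^ d)" for k
      using R by (subst nn_integral_cmult_indicator) (auto simp: emeasure_ball V_def d_def simp del: power_Suc)
    moreover have "(\<lambda>y. ennreal (?c k) * indicator (ball (0::'a) (R * (1/2)^k)) y) \<in> borel_measurable lborel" for k
      by (intro borel_measurable_times_ennreal borel_measurable_const borel_measurable_indicator) simp
    ultimately show ?thesis by (simp only: nn_integral_suminf)
  qed
  also have "\<dots> = (\<Sum>k. ennreal (V * 2 powr a * R powr (real d - a) * q ^ k))"
  proof (intro suminf_cong)
    fix k
    have h: "(1/2::real) ^ j = (1/2) powr real j" for j by (simp add: powr_realpow)
    have q': "q ^ k = (1/2) powr ((real d - a) * real k)"
      unfolding q_def by (simp add: powr_power mult.commute)
    have "?c k = R powr (- a) * ((1/2) powr real (Suc k)) powr (- a)"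
      unfolding h by (rule powr_mult)
    also have "((1/2::real) powr real (Suc k)) powr (- a) = (1/2) powr (- a) * (1/2) powr (- a * real k)"
      by (simp only: powr_powr flip: powr_add) (simp add: algebra_simps)
    also have "(1/2::real) powr (- a) = 2 powr a"
      by (simp add: powr_divide powr_minus)
    finally have "?c k = R powr (- a) * (2 powr a * (1/2) powr (- a * real k))" .
    moreover have "(R * (1/2)^k) ^ d = R powr (real d) * (1/2) powr (real k * real d)"
      using R h[of "k * d"] by (simp add: power_mult_distrib powr_realpow power_mult)
    ultimately have "?c k * (V * (R * (1/2)^k) ^ d)
      = V * 2 powr a * (R powr (-a) * R powr (real d)) * ((1/2) powr (- a * real k) * (1/2) powr (real k * real d))"
      by (simp only: mult_ac)
    also have "\<dots> = V * 2 powr a * R powr (real d - a) * q ^ k"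
      unfolding q' powr_add[symmetric] by (simp add: algebra_simps)
    finally have e: "?c k * (V * (R * (1/2)^k) ^ d) = V * 2 powr a * R powr (real d - a) * q ^ k" .
    show "ennreal (?c k) * ennreal (V * (R * (1/2)^k) ^ d)
      = ennreal (V * 2 powr a * R powr (real d - a) * q ^ k)"
      unfolding e[symmetric] using V R by (intro ennreal_mult[symmetric]) auto
  qed
  also have "\<dots> = ennreal (\<Sum>k. V * 2 powr a * R powr (real d - a) * q ^ k)"
    using V q by (intro suminf_ennreal2 summable_mult summable_geometric) auto
  also have "(\<Sum>k. V * 2 powr a * R powr (real d - a) * q ^ k) = K * R powr (real d - a)"
    using q by (simp add: suminf_mult suminf_geometric K_def)
  finally show "(\<integral>\<^sup>+y. ennreal (norm y powr (- a)) * indicator (ball (0::'a) R) y \<partial>lborel)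
    \<le> ennreal (K * R powr (real DIM('a) - a))" by (simp add: d_def)
qed

definition heat_kernel :: "real \<Rightarrow> 'a::euclidean_space \<Rightarrow> real" where
  "heat_kernel t z = (4 * pi * t) powr (- (real DIM('a) / 2)) * exp (- (norm z)\<^sup>2 / (4 * t))"

lemma heat_kernel_nonneg [simp]: "0 \<le> heat_kernel t z"
  by (simp add: heat_kernel_def)

lemma measurable_heat_kernel [measurable]:
  "(\<lambda>y. heat_kernel t (x - y)) \<in> borel_measurable borel"
  unfolding heat_kernel_def by measurable

lemma heat_kernel_eq_prod_normal_density:
  fixes x y :: "'a::euclidean_space"
  assumes "0 < t"
  shows "heat_kernel t (x - y) = (\<Prod>b\<in>Basis. normal_density (x \<bullet> b) (sqrt (2 * t)) (y \<bullet> b))"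
proof -
  have "(norm (x - y))\<^sup>2 = (\<Sum>b\<in>Basis. (y \<bullet> b - x \<bullet> b)\<^sup>2)"
    unfolding norm_minus_commute[of x y]
    by (subst power2_norm_eq_inner, subst euclidean_inner) (simp add: power2_eq_square inner_diff_left)
  moreover have "(1 / sqrt (4 * pi * t)) ^ DIM('a) = (4 * pi * t) powr (- (real DIM('a) / 2))"
  proof -
    have "1 / sqrt (4 * pi * t) = (4 * pi * t) powr (- (1 / 2))"
      using assms by (simp add: powr_minus_divide powr_half_sqrt)
    then show ?thesis using assms by (simp add: powr_power)
  qed
  moreover have "exp (- (\<Sum>b\<in>Basis. (y \<bullet> b - x \<bullet> b)\<^sup>2) / (4 * t))
    = (\<Prod>b\<in>Basis. exp (- (y \<bullet> b - x \<bullet> b)\<^sup>2 / (4 * t)))"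
    by (simp add: sum_divide_distrib flip: exp_sum sum_negf)
  moreover have "(\<Prod>b\<in>Basis. normal_density (x \<bullet> b) (sqrt (2 * t)) (y \<bullet> b))
    = (\<Prod>b\<in>Basis. 1 / sqrt (4 * pi * t) * exp (- (y \<bullet> b - x \<bullet> b)\<^sup>2 / (4 * t)))"
    using assms by (simp add: normal_density_def mult.assoc)
  ultimately show ?thesis
    by (simp only: heat_kernel_def prod.distrib prod_constant)
qed

lemma nn_integral_heat_kernel:
  fixes x :: "'a::euclidean_space"
  assumes "0 < t"
  shows "(\<integral>\<^sup>+y. ennreal (heat_kernel t (x - y)) \<partial>lborel) = 1"
proof -
  have "(\<integral>\<^sup>+y. ennreal (heat_kernel t (x - y)) \<partial>lborel)
    = (\<integral>\<^sup>+y. (\<Prod>b\<in>Basis. ennreal (normal_density (x \<bullet> b) (sqrt (2 * t)) (y \<bullet> b))) \<partial>lborel)"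
    using assms by (simp add: heat_kernel_eq_prod_normal_density prod_ennreal)
  also have "\<dots> = (\<Prod>b\<in>Basis. \<integral>\<^sup>+s. ennreal (normal_density (x \<bullet> b) (sqrt (2 * t)) s) \<partial>lborel)"
    by (rule nn_integral_lborel_prod) auto
  also have "\<dots> = 1"
    using assms by (intro prod.neutral ballI) (subst nn_integral_eq_integral, auto)
  finally show ?thesis .
qed

lemma heat_kernel_le:
  fixes z :: "'a::euclidean_space"
  assumes "0 < t" "sqrt t \<le> r" "r / 2 \<le> norm z \<or> r = sqrt t"
  shows "heat_kernel t z \<le> fact DIM('a) * 16 ^ DIM('a) * r powr (- real DIM('a))"
proof -
  define d where "d = DIM('a)"
  define w where "w = r / sqrt t"
  have w: "1 \<le> w" using assms by (simp add: w_def)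
  have "sqrt t > 0" using assms by simp
  then have r: "r > 0" using assms(2) by linarith
  have A: "exp (- (norm z)\<^sup>2 / (4 * t)) * w ^ d \<le> fact d * 16 ^ d"
  proof (cases "r = sqrt t")
    case True
    then have "w = 1" using assms by (simp add: w_def)
    moreover have "exp (- (norm z)\<^sup>2 / (4 * t)) \<le> 1" using assms by simp
    moreover have "1 * 1 \<le> (fact d * 16 ^ d :: real)" by (intro mult_mono) auto
    ultimately show ?thesis by (simp del: exp_le_one_iff)
  next
    case False
    then have "r / 2 \<le> norm z" using assms by simp
    then have "(r / 2)\<^sup>2 \<le> (norm z)\<^sup>2" using r by (intro power_mono) auto
    then have u: "w\<^sup>2 / 16 \<le> (norm z)\<^sup>2 / (4 * t)"
      using assms by (simp add: w_def power_divide field_simps)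
    have "w ^ d \<le> (w\<^sup>2) ^ d" using w by (intro power_mono) (auto simp: power2_eq_square)
    also have "\<dots> = 16 ^ d * fact d * ((w\<^sup>2/16) ^ d /\<^sub>R fact d)"
      by (simp add: power_divide)
    also have "(w\<^sup>2/16) ^ d /\<^sub>R fact d \<le> exp (w\<^sup>2 / 16)"
      using sum_le_suminf[OF summable_exp_generic, of "{d}" "w\<^sup>2/16"] by (simp add: exp_def)
    also have "exp (w\<^sup>2 / 16) \<le> exp ((norm z)\<^sup>2 / (4 * t))" using u by simp
    finally show ?thesis by (simp add: exp_minus field_simps)
  qed
  have "heat_kernel t z \<le> t powr (- (real d / 2)) * exp (- (norm z)\<^sup>2 / (4 * t))"
  proof -
    have "t \<le> 4 * pi * t" using assms pi_gt3 by simp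
    then show ?thesis
      unfolding heat_kernel_def d_def using assms
      by (intro mult_right_mono powr_mono2') auto
  qed
  also have "t powr (- (real d / 2)) = w ^ d * r powr (- real d)"
  proof -
    have "sqrt t powr (- real d) = t powr (- (real d / 2))"
      using assms by (simp add: powr_half_sqrt[symmetric] powr_powr)
    moreover have "w ^ d = r powr real d * sqrt t powr (- real d)"
      using \<open>0 < sqrt t\<close> r by (simp add: w_def power_divide powr_realpow powr_minus_divide)
    ultimately show ?thesis using r by (simp add: powr_minus)
  qed
  also have "w ^ d * r powr (- real d) * exp (- (norm z)\<^sup>2 / (4 * t))
    = (exp (- (norm z)\<^sup>2 / (4 * t)) * w ^ d) * r powr (- real d)" by simp
  also have "\<dots> \<le> fact d * 16 ^ d * r powr (- real d)"
    by (intro mult_right_mono A) simp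
  finally show ?thesis by (simp add: d_def)
qed

lemma nn_integral_heat_kernel_norm_powr_le:
  fixes a :: real
  assumes "0 \<le> a" "a < real DIM('a::euclidean_space)"
  obtains K where "0 \<le> K"
    "\<And>t (x::'a). 0 < t \<Longrightarrow>
      (\<integral>\<^sup>+y. ennreal (heat_kernel t (x - y) * norm y powr (- a)) \<partial>lborel)
      \<le> ennreal (K * max (norm x) (sqrt t) powr (- a))"
proof -
  define d where "d = DIM('a)"
  obtain K where K: "0 \<le> K" "\<And>R. 0 < R \<Longrightarrow> (\<integral>\<^sup>+y. ennreal (norm y powr (- a)) * indicator (ball (0::'a) R) y \<partial>lborel)
      \<le> ennreal (K * R powr (real d - a))"
    using nn_integral_norm_powr_ball_le[OF assms] unfolding d_def by metis
  define D :: real where "D = fact d * 16 ^ d"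
  define L where "L = 2 powr a + D * (K * (1/2) powr (real d - a))"
  show ?thesis
  proof
    show "0 \<le> L" using K by (simp add: L_def D_def)
    fix t :: real and x :: 'a assume t: "0 < t"
    define r where "r = max (norm x) (sqrt t)"
    have r: "0 < r" using t by (simp add: r_def less_max_iff_disj)
    have "(\<integral>\<^sup>+y. ennreal (heat_kernel t (x - y) * norm y powr (- a)) \<partial>lborel)
      \<le> (\<integral>\<^sup>+y. ennreal ((r/2) powr (- a)) * ennreal (heat_kernel t (x - y))
            + ennreal (D * r powr (- real d)) * (ennreal (norm y powr (- a)) * indicator (ball 0 (r/2)) y) \<partial>lborel)"
    proof (rule nn_integral_mono)
      fix y :: 'a
      show "ennreal (heat_kernel t (x - y) * norm y powr (- a))
        \<le> ennreal ((r/2) powr (- a)) * ennreal (heat_kernel t (x - y))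
          + ennreal (D * r powr (- real d)) * (ennreal (norm y powr (- a)) * indicator (ball 0 (r/2)) y)"
      proof (cases "norm y < r/2")
        case True
        have "r / 2 \<le> norm (x - y) \<or> r = sqrt t"
          using True norm_triangle_ineq2[of x y] by (auto simp: r_def max_def split: if_splits)
        then have "heat_kernel t (x - y) \<le> D * r powr (- real d)"
          using heat_kernel_le[of t r "x - y"] t by (simp add: D_def d_def r_def)
        then have "ennreal (heat_kernel t (x - y) * norm y powr (- a))
          \<le> ennreal (D * r powr (- real d)) * ennreal (norm y powr (- a))"
          by (subst ennreal_mult[symmetric]) (auto simp: D_def intro!: ennreal_leI mult_right_mono)
        then show ?thesis using True by (simp add: add_increasing)
      next
        case False
        then have "norm y powr (- a) \<le> (r/2) powr (- a)"
          using r assms by (intro powr_mono2') auto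
        then have "ennreal (heat_kernel t (x - y) * norm y powr (- a))
          \<le> ennreal ((r/2) powr (- a) * heat_kernel t (x - y))"
          by (intro ennreal_leI) (simp add: mult.commute mult_left_mono)
        then show ?thesis using False by (simp add: ennreal_mult)
      qed
    qed
    also have "\<dots> = ennreal ((r/2) powr (- a)) +
       ennreal (D * r powr (- real d)) *
         (\<integral>\<^sup>+y. ennreal (norm y powr (- a)) * indicator (ball (0::'a) (r/2)) y \<partial>lborel)"
    proof -
      have m: "(\<lambda>y. ennreal (heat_kernel t (x - y))) \<in> borel_measurable lborel"
        "(\<lambda>y::'a. ennreal (norm y powr (- a)) * indicator (ball 0 (r/2)) y) \<in> borel_measurable lborel"
        by (auto intro!: borel_measurable_times_ennreal borel_measurable_indicator)
      show ?thesis
        by (simp only: nn_integral_add[OF borel_measurable_times_ennreal[OF borel_measurable_const m(1)]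
            borel_measurable_times_ennreal[OF borel_measurable_const m(2)]]
            nn_integral_cmult[OF m(1)] nn_integral_cmult[OF m(2)] nn_integral_heat_kernel[OF t] mult_1_right)
    qed
    also have "\<dots> \<le> ennreal ((r/2) powr (- a)) +
       ennreal (D * r powr (- real d)) * ennreal (K * (r/2) powr (real d - a))"
      using r by (intro add_left_mono mult_left_mono K) auto
    also have "\<dots> = ennreal ((r/2) powr (- a) + (D * r powr (- real d)) * (K * (r/2) powr (real d - a)))"
      using K by (simp add: D_def flip: ennreal_mult ennreal_plus)
    also have "(r/2) powr (- a) + (D * r powr (- real d)) * (K * (r/2) powr (real d - a)) = L * r powr (- a)"
    proof -
      have "(r/2) powr (- a) = 2 powr a * r powr (- a)"
        using r by (simp add: powr_divide powr_minus field_simps)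
      moreover have "(r/2) powr (real d - a) = (1/2) powr (real d - a) * r powr (real d - a)"
        using r powr_mult[of "1/2" r "real d - a"] by simp
      moreover have "r powr (real d - a) = r powr (real d) * r powr (- a)"
        by (simp flip: powr_add)
      moreover have "r powr (- real d) * r powr (real d) = 1"
        using r by (simp flip: powr_add)
      ultimately show ?thesis by (simp add: L_def algebra_simps)
    qed
    finally show "(\<integral>\<^sup>+y. ennreal (heat_kernel t (x - y) * norm y powr (- a)) \<partial>lborel)
      \<le> ennreal (L * max (norm x) (sqrt t) powr (- a))" by (simp add: r_def)
  qed
qed

lemma norm_heat_semigroup_le:
  fixes a :: real
  assumes "0 \<le> a" "a < real DIM('a::euclidean_space)"
  obtains K where "0 \<le> K"
    "\<And>(f :: 'a \<Rightarrow> 'b::euclidean_space) M t x. \<lbrakk>0 \<le> M; AE y in lborel. norm (f y) \<le> M * norm y powr (- a); 0 < t\<rbrakk>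
      \<Longrightarrow> norm (heat_semigroup t f x) \<le> K * M * max (norm x) (sqrt t) powr (- a)"
proof -
  obtain K where K: "0 \<le> K" "\<And>t (x::'a). 0 < t \<Longrightarrow>
      (\<integral>\<^sup>+y. ennreal (heat_kernel t (x - y) * norm y powr (- a)) \<partial>lborel)
      \<le> ennreal (K * max (norm x) (sqrt t) powr (- a))"
    using nn_integral_heat_kernel_norm_powr_le[OF assms] by metis
  show ?thesis
  proof
    fix f :: "'a \<Rightarrow> 'b" and M t :: real and x :: 'a
    assume M: "0 \<le> M" and f: "AE y in lborel. norm (f y) \<le> M * norm y powr (- a)" and t: "0 < t"
    let ?r = "max (norm x) (sqrt t)"
    have eq: "heat_semigroup t f x = (LINT y|lebesgue. heat_kernel t (x - y) *\<^sub>R f y)"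
      by (simp add: heat_semigroup_def heat_kernel_def)
    show "norm (heat_semigroup t f x) \<le> K * M * ?r powr (- a)"
    proof (cases "integrable lebesgue (\<lambda>y. heat_kernel t (x - y) *\<^sub>R f y)")
      case True
      then have "ennreal (norm (heat_semigroup t f x))
        \<le> (\<integral>\<^sup>+y. ennreal (norm (heat_kernel t (x - y) *\<^sub>R f y)) \<partial>lebesgue)"
        unfolding eq by (rule integral_norm_bound_ennreal)
      also have "\<dots> = (\<integral>\<^sup>+y. ennreal (norm (heat_kernel t (x - y) *\<^sub>R f y)) \<partial>lborel)"
        by (rule nn_integral_completion)
      also have "\<dots> \<le> (\<integral>\<^sup>+y. ennreal M * ennreal (heat_kernel t (x - y) * norm y powr (- a)) \<partial>lborel)"
      proof (rule nn_integral_mono_AE)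
        show "AE y in lborel. ennreal (norm (heat_kernel t (x - y) *\<^sub>R f y))
          \<le> ennreal M * ennreal (heat_kernel t (x - y) * norm y powr (- a))"
          using f
        proof eventually_elim
          case (elim y)
          from mult_left_mono[OF elim, of "heat_kernel t (x - y)"] show ?case
            using M by (simp add: ennreal_leI mult_ac flip: ennreal_mult)
        qed
      qed
      also have "\<dots> = ennreal M * (\<integral>\<^sup>+y. ennreal (heat_kernel t (x - y) * norm y powr (- a)) \<partial>lborel)"
        by (rule nn_integral_cmult) measurable
      also have "\<dots> \<le> ennreal M * ennreal (K * ?r powr (- a))"
        using t by (intro mult_left_mono K) auto
      also have "\<dots> = ennreal (K * M * ?r powr (- a))"
        using M K by (simp add: mult_ac flip: ennreal_mult)
      finally show ?thesis using M K by (simp add: ennreal_le_iff)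
    next
      case False
      then show ?thesis unfolding eq using M K by (simp add: not_integrable_integral_eq)
    qed
  qed (rule K)
qed

lemma norm_pow_mult_powr_le:
  assumes "0 \<le> b" "b \<le> a" "0 < t"
  shows "norm_pow b x * t powr ((a - b) / 2) \<le> max (norm x) (sqrt t) powr a"
proof -
  let ?r = "max (norm x) (sqrt t)"
  have r: "0 < ?r" using assms by (simp add: less_max_iff_disj)
  have "norm_pow b x \<le> ?r powr b"
    using assms r by (auto simp: norm_pow_def intro!: powr_mono2)
  moreover have "t powr ((a - b) / 2) \<le> ?r powr (a - b)"
  proof -
    have "t powr ((a - b) / 2) = sqrt t powr (a - b)"
      using assms by (simp add: powr_half_sqrt[symmetric] powr_powr)
    also have "\<dots> \<le> ?r powr (a - b)" using assms by (intro powr_mono2) auto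
    finally show ?thesis .
  qed
  ultimately have "norm_pow b x * t powr ((a - b) / 2) \<le> ?r powr b * ?r powr (a - b)"
    by (intro mult_mono) auto
  then show ?thesis by (simp flip: powr_add)
qed

lemma norm_pow_nonneg [simp]: "0 \<le> norm_pow a x"
  by (simp add: norm_pow_def)

lemma wnorm_nonneg: "0 \<le> wnorm b (u :: 'a::euclidean_space \<Rightarrow> 'b::euclidean_space)"
proof (cases "(\<lambda>x. ereal (norm_pow b x * norm (u x))) \<in> borel_measurable lebesgue")
  case True
  have "0 = esssup (lebesgue :: 'a measure) (\<lambda>x. 0 :: ereal)"
    by (subst esssup_const) auto
  also have "\<dots> \<le> wnorm b u" unfolding wnorm_def by (rule esssup_mono) auto
  finally show ?thesis .
qed (simp add: wnorm_def esssup_non_measurable)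

lemma wLinfty_real_wnorm:
  assumes "u \<in> wLinfty b"
  obtains m where "0 \<le> m" "wnorm b u = ereal m"
    "AE y in lborel. norm_pow b y * norm (u y) \<le> m"
proof -
  from assms have "wnorm b u < \<infinity>" by (simp add: wLinfty_def)
  with wnorm_nonneg[of b u] obtain m where m: "0 \<le> m" "wnorm b u = ereal m"
    by (cases "wnorm b u") auto
  have "AE y in lebesgue. ereal (norm_pow b y * norm (u y)) \<le> ereal m"
    unfolding m(2)[symmetric] wnorm_def by (rule esssup_AE)
  then show ?thesis using that m by (simp add: AE_completion_iff)
qed

lemma AE_norm_le_of_interpolation:
  fixes u :: "'a::euclidean_space \<Rightarrow> 'b::euclidean_space"
  assumes "AE y in lborel. norm_pow c y * norm (u y) \<le> m"
    and "AE y in lborel. norm_pow b y * norm (u y) \<le> m'"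
    and "c \<le> a" "a \<le> b"
  shows "AE y in lborel. norm (u y) \<le> (m + m') * norm y powr (- a)"
  using assms(1,2) AE_lborel_singleton[of "0::'a"]
proof eventually_elim
  case (elim y)
  then have y: "0 < norm y" by simp
  have "norm y powr a \<le> norm y powr c + norm y powr b"
  proof (cases "norm y \<le> 1")
    case True
    then have "norm y powr a \<le> norm y powr c" using y assms by (intro powr_mono') auto
    then show ?thesis by (simp add: add_increasing2)
  next
    case False
    then have "norm y powr a \<le> norm y powr b" using y assms by (intro powr_mono) auto
    then show ?thesis by (simp add: add_increasing)
  qed
  from mult_right_mono[OF this, of "norm (u y)"]
  have "norm y powr a * norm (u y) \<le> m + m'"
    using elim y by (simp add: norm_pow_def algebra_simps split: if_splits)
  then show ?case using y by (simp add: powr_minus field_simps)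
qed

lemma weighted_heat_semigroup_le:
  fixes a b c e :: real
  assumes "0 \<le> c" "c \<le> a" "a \<le> e" "e < real DIM('a::euclidean_space)" "0 \<le> b" "b \<le> a"
  obtains K where "0 \<le> K"
    "\<And>(f :: 'a \<Rightarrow> 'b::euclidean_space) t x. \<lbrakk>f \<in> wLinfty c; f \<in> wLinfty e; 0 < t\<rbrakk>
      \<Longrightarrow> ereal (norm_pow b x * t powr ((a - b) / 2) * norm (heat_semigroup t f x))
        \<le> ereal K * (wnorm c f + wnorm e f)"
proof -
  have a: "0 \<le> a" "a < real DIM('a)" using assms by auto
  obtain K where K: "0 \<le> K"
    "\<And>(f :: 'a \<Rightarrow> 'b) M t x. \<lbrakk>0 \<le> M; AE y in lborel. norm (f y) \<le> M * norm y powr (- a); 0 < t\<rbrakk>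
      \<Longrightarrow> norm (heat_semigroup t f x) \<le> K * M * max (norm x) (sqrt t) powr (- a)"
    by (rule norm_heat_semigroup_le[OF a, where 'b='b]) (rule that)
  show ?thesis
  proof
    fix f :: "'a \<Rightarrow> 'b" and t :: real and x :: 'a
    assume f: "f \<in> wLinfty c" "f \<in> wLinfty e" and t: "0 < t"
    let ?r = "max (norm x) (sqrt t)"
    have r: "0 < ?r" using t by (simp add: less_max_iff_disj)
    obtain m where m: "0 \<le> m" "wnorm c f = ereal m" "AE y in lborel. norm_pow c y * norm (f y) \<le> m"
      using wLinfty_real_wnorm[OF f(1)] .
    obtain n where n: "0 \<le> n" "wnorm e f = ereal n" "AE y in lborel. norm_pow e y * norm (f y) \<le> n"
      using wLinfty_real_wnorm[OF f(2)] .
    have "norm (heat_semigroup t f x) \<le> K * (m + n) * ?r powr (- a)"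
      using AE_norm_le_of_interpolation[OF m(3) n(3)] assms m n t by (intro K) auto
    then have "norm_pow b x * t powr ((a - b) / 2) * norm (heat_semigroup t f x)
      \<le> ?r powr a * (K * (m + n) * ?r powr (- a))"
      using assms t by (intro mult_mono norm_pow_mult_powr_le) auto
    also have "\<dots> = K * (m + n)"
      using r by (simp add: powr_minus)
    finally show "ereal (norm_pow b x * t powr ((a - b) / 2) * norm (heat_semigroup t f x))
        \<le> ereal K * (wnorm c f + wnorm e f)" using m n by simp
  qed (rule K)
qed

theorem theorem1:
  fixes \<gamma> \<beta> \<gamma>' \<alpha> \<beta>' :: real
  assumes "0 \<le> \<gamma>" and "\<gamma> \<le> 1" and "1 \<le> \<beta>" and "\<beta> < real CARD('d::finite)"
    and "0 \<le> \<gamma>'" and "\<gamma>' \<le> \<gamma>"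
    and "0 \<le> \<alpha>" and "\<alpha> \<le> 1"
    and "0 \<le> \<beta>'" and "\<beta>' \<le> \<beta>"
  shows "\<exists>C::real. \<forall>f :: real ^ 'd \<Rightarrow> 'b::euclidean_space. f \<in> wLinfty \<gamma> \<inter> wLinfty \<beta> \<longrightarrow>
    (SUP (x, t) \<in> UNIV \<times> {0<..}.
       ereal ((norm_pow \<gamma>' x * t powr ((\<gamma> - \<gamma>') / 2)
             + norm_pow \<alpha> x * t powr ((1 - \<alpha>) / 2)
             + norm_pow \<beta>' x * t powr ((\<beta> - \<beta>') / 2)) * norm (heat_semigroup t f x)))
    \<le> ereal C * (wnorm \<gamma> f + wnorm \<beta> f)"
proof -
  have d: "\<beta> < real DIM(real ^ 'd)" using assms by simp
  have bound: "\<exists>K. 0 \<le> K \<and> (\<forall>(f :: real ^ 'd \<Rightarrow> 'b) t x. f \<in> wLinfty \<gamma> \<longrightarrow> f \<in> wLinfty \<beta> \<longrightarrow> 0 < t \<longrightarrow>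
      ereal (norm_pow b x * t powr ((a - b) / 2) * norm (heat_semigroup t f x))
        \<le> ereal K * (wnorm \<gamma> f + wnorm \<beta> f))"
    if "\<gamma> \<le> a" "a \<le> \<beta>" "0 \<le> b" "b \<le> a" for a b
    using weighted_heat_semigroup_le[OF assms(1) that(1,2) d that(3,4), where 'b='b] by metis
  obtain K1 where K1: "0 \<le> K1" "\<And>(f :: real ^ 'd \<Rightarrow> 'b) t x. \<lbrakk>f \<in> wLinfty \<gamma>; f \<in> wLinfty \<beta>; 0 < t\<rbrakk> \<Longrightarrow>
      ereal (norm_pow \<gamma>' x * t powr ((\<gamma> - \<gamma>') / 2) * norm (heat_semigroup t f x))
        \<le> ereal K1 * (wnorm \<gamma> f + wnorm \<beta> f)"
    using bound[of \<gamma> \<gamma>'] assms by auto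
  obtain K2 where K2: "0 \<le> K2" "\<And>(f :: real ^ 'd \<Rightarrow> 'b) t x. \<lbrakk>f \<in> wLinfty \<gamma>; f \<in> wLinfty \<beta>; 0 < t\<rbrakk> \<Longrightarrow>
      ereal (norm_pow \<alpha> x * t powr ((1 - \<alpha>) / 2) * norm (heat_semigroup t f x))
        \<le> ereal K2 * (wnorm \<gamma> f + wnorm \<beta> f)"
    using bound[of 1 \<alpha>] assms by auto
  obtain K3 where K3: "0 \<le> K3" "\<And>(f :: real ^ 'd \<Rightarrow> 'b) t x. \<lbrakk>f \<in> wLinfty \<gamma>; f \<in> wLinfty \<beta>; 0 < t\<rbrakk> \<Longrightarrow>
      ereal (norm_pow \<beta>' x * t powr ((\<beta> - \<beta>') / 2) * norm (heat_semigroup t f x))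
        \<le> ereal K3 * (wnorm \<gamma> f + wnorm \<beta> f)"
    using bound[of \<beta> \<beta>'] assms by auto
  show ?thesis
  proof (intro exI[of _ "K1 + K2 + K3"] allI impI SUP_least, clarsimp simp del: plus_ereal.simps)
    fix f :: "real ^ 'd \<Rightarrow> 'b" and x :: "real ^ 'd" and t :: real
    assume f: "f \<in> wLinfty \<gamma>" "f \<in> wLinfty \<beta>" and t: "0 < t"
    obtain m where "wnorm \<gamma> f = ereal m" using wLinfty_real_wnorm[OF f(1)] .
    moreover obtain n where "wnorm \<beta> f = ereal n" using wLinfty_real_wnorm[OF f(2)] .
    ultimately show "ereal ((norm_pow \<gamma>' x * t powr ((\<gamma> - \<gamma>') / 2) + norm_pow \<alpha> x * t powr ((1 - \<alpha>) / 2)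
        + norm_pow \<beta>' x * t powr ((\<beta> - \<beta>') / 2)) * norm (heat_semigroup t f x))
      \<le> ereal (K1 + K2 + K3) * (wnorm \<gamma> f + wnorm \<beta> f)"
      using K1(2)[OF f t, of x] K2(2)[OF f t, of x] K3(2)[OF f t, of x]
      by (simp add: distrib_right)
  qed
qed

end
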